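(* Let $T$ be a positive integer, let $B_1,\ldots,B_m$ be nonzero symmetric positive semidefinite $n\times n$ real matrices, and let $\gamma,\eta,\delta_L,\delta_U>0$. For given symmetric $X_L,X_U$, consider the system in the unknowns $\alpha\in\mathbb{R}_+$ and $j\in\{1,\ldots,m\}$: $$\delta_U\ \ge\ \frac{\exp(\gamma\alpha\,\mathrm{tr}\,B_j)-1}{\mathrm{tr}\,B_j}\,\langle X_U,B_j\rangle,\qquad \delta_L\ \le\ \frac{1-\exp(-\gamma\alpha\,\mathrm{tr}\,B_j)}{\mathrm{tr}\,B_j}\,\langle X_L,B_j\rangle. \quad (\ast)$$ For each $t\in\{0,\ldots,T+1\}$ let $A(t),W_L(t),W_U(t)$ be symmetric $n\times n$ matrices, $\alpha(t)\in\mathbb{R}_+$ and $j(t)\in\{1,\ldots,m\}$, and suppose: (i) $A(t)=\sum_{\tau=1}^t\alpha(\tau)B_{j(\tau)}$ for all $t\in\{0,\ldots,T\}$; (ii) $W_U(t+1)=\exp(\gamma A(t))$ and $W_L(t+1)=\exp(-\gamma A(t))$ for all $t\in\{0,\ldots,T\}$; (iii) for every $t\in\{1,\ldots,T\}$, $(\alpha,j)=(\alpha(t),j(t))$ is a solution of $(\ast)$ with $X_U=W_U(t)/\mathrm{tr}\,W_U(t)$ and $X_L=W_L(t)/\mathrm{tr}\,W_L(t)$. Then every eigenvalue $\lambda$ of $A(T)/T$ satisfies $$\frac{\log(1-\delta_L)^{-1}}{\gamma}-\frac{\log n}{T\gamma}\ \le\ \lambda\ \le\ \frac{\log(1+\delta_U)}{\gamma}+\frac{\log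 n}{T\gamma}.$$
   Context: $\exp$ of a symmetric matrix is the matrix exponential; $\log$ is the natural logarithm; $\langle X,Y\rangle=\mathrm{tr}(XY)$ is the trace inner product; $\mathbb{R}_+$ denotes the nonnegative reals. *)

theory Defs
  imports "HOL-Analysis.Analysis"
begin

(* The type class operations 1, *, ^ on real^'n^'n act componentwise,
   so matrix powers are defined from the matrix product **. *)
primrec mat_pow :: "real^'n^'n \<Rightarrow> nat \<Rightarrow> real^'n^'n" where
  "mat_pow A 0 = mat 1"
| "mat_pow A (Suc k) = A ** mat_pow A k"

definition mat_exp :: "real^'n^'n \<Rightarrow> real^'n^'n" where
  "mat_exp A = (\<Sum>k. (1 / fact k) *\<^sub>R mat_pow A k)"

definition symmetric_mat :: "real^'n^'n \<Rightarrow> bool" where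
  "symmetric_mat A \<longleftrightarrow> transpose A = A"

definition psd :: "real^'n^'n \<Rightarrow> bool" where
  "psd A \<longleftrightarrow> symmetric_mat A \<and> (\<forall>x. 0 \<le> x \<bullet> (A *v x))"

definition eigenvalue :: "real^'n^'n \<Rightarrow> real \<Rightarrow> bool" where
  "eigenvalue A l \<longleftrightarrow> (\<exists>v. v \<noteq> 0 \<and> A *v v = l *\<^sub>R v)"

definition trace_inner :: "real^'n^'n \<Rightarrow> real^'n^'n \<Rightarrow> real" where
  "trace_inner X Y = trace (X ** Y)"

definition solves_system ::
  "real \<Rightarrow> real \<Rightarrow> real \<Rightarrow> nat \<Rightarrow> (nat \<Rightarrow> real^'n^'n) \<Rightarrow>
   real^'n^'n \<Rightarrow> real^'n^'n \<Rightarrow> real \<Rightarrow> nat \<Rightarrow> bool" where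
  "solves_system \<gamma> \<delta>L \<delta>U m B XL XU a j \<longleftrightarrow>
     0 \<le> a \<and> j \<in> {1..m} \<and>
     \<delta>U \<ge> (exp (\<gamma> * a * trace (B j)) - 1) / trace (B j) * trace_inner XU (B j) \<and>
     \<delta>L \<le> (1 - exp (- (\<gamma> * a * trace (B j)))) / trace (B j) * trace_inner XL (B j)"

end

(* For symmetric H and psd B with trace b, the function f(s) = tr exp(H + s B) satisfies
   f'' <= b f': in an eigenbasis of H + s B this is an average of the inequalities
   x^i y^l + x^l y^i <= x^(i+l) + y^(i+l), together with B^2 <= b B. Hence
   f(s) <= f(0) + (exp(s b) - 1) / b * f'(0) for s of either sign. With f'(0) = tr(B exp H), each
   step multiplies tr WU by at most 1 + deltaU and tr WL by at most 1 - deltaL. Both traces start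
   at n and dominate the exponential of every eigenvalue of their exponents.
   The differential inequality is established for the Taylor polynomials of f, so the matrix
   exponential itself is never differentiated. *)
theory Submission
  imports Defs
begin

section \<open>Symmetric matrices, the trace and rank-one matrices\<close>

lemma symmetric_mat_inner: "x \<bullet> (A *v y) = (A *v x) \<bullet> y" if "symmetric_mat A"
  using that by (metis dot_lmul_matrix symmetric_mat_def vector_transpose_matrix)

lemma symmetric_mat_add: "symmetric_mat (A + B)" if "symmetric_mat A" "symmetric_mat B"
  using that by (simp add: symmetric_mat_def transpose_def vec_eq_iff)

lemma symmetric_mat_scaleR: "symmetric_mat (c *\<^sub>R A)" if "symmetric_mat A"
  using that by (simp add: symmetric_mat_def transpose_scalar)

lemma symmetric_mat_mat: "symmetric_mat (mat c)"
  by (simp add: symmetric_mat_def)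

text \<open>Supplies, through the interpretation below, the rules that carry sums and derivatives
  through the matrix product.\<close>

lemma bounded_bilinear_matrix_mult:
  "bounded_bilinear ((**) :: real^'n^'m \<Rightarrow> real^'p^'n \<Rightarrow> real^'p^'m)"
proof -
  have "bilinear ((**) :: real^'n^'m \<Rightarrow> real^'p^'n \<Rightarrow> real^'p^'m)"
    by (auto simp: bilinear_def matrix_matrix_mult_def vec_eq_iff
        sum_distrib_left algebra_simps sum.distrib intro!: linearI)
  then show ?thesis
    using bilinear_conv_bounded_bilinear by blast
qed

interpretation matrix_mult: bounded_bilinear "(**) :: real^'n^'m \<Rightarrow> real^'p^'n \<Rightarrow> real^'p^'m"
  by (rule bounded_bilinear_matrix_mult)

lemma bounded_linear_trace: "bounded_linear (trace :: real^'n^'n \<Rightarrow> real)"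
  by (auto simp: linear_conv_bounded_linear[symmetric] trace_def sum_distrib_left sum.distrib intro!: linearI)

lemma trace_sum: "trace (\<Sum>i\<in>I. M i) = (\<Sum>i\<in>I. trace (M i))"
  for M :: "'i \<Rightarrow> real^'n^'n"
  by (rule linear_sum[OF bounded_linear.linear[OF bounded_linear_trace]])

lemma trace_scaleR: "trace (c *\<^sub>R M) = c * trace M"
  for M :: "real^'n^'n"
  by (simp add: trace_def sum_distrib_left)

lemma matrix_vector_mult_sum_left: "(\<Sum>i\<in>I. M i) *v x = (\<Sum>i\<in>I. M i *v x)"
  for M :: "'i \<Rightarrow> real^'n^'m"
  by (induction I rule: infinite_finite_induct) (auto simp: matrix_vector_mult_add_rdistrib)

lemma mat_vector_mult: "mat c *v x = c *\<^sub>R x" for x :: "real^'n"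
  by (simp add: matrix_vector_mult_def mat_def vec_eq_iff if_distrib if_distribR cong: if_cong)

text \<open>This is v v^T; for a unit vector it is the orthogonal projection onto the line spanned
  by v.\<close>

definition outer :: "real^'n \<Rightarrow> real^'n^'n" where
  "outer v = (\<chi> a b. v $ a * v $ b)"

lemma outer_mult_vector: "outer v *v x = (v \<bullet> x) *\<^sub>R v"
  by (simp add: outer_def matrix_vector_mult_def vec_eq_iff inner_vec_def sum_distrib_left mult_ac)

lemma trace_outer_mult: "trace (outer v ** M) = v \<bullet> (M *v v)"
proof -
  have "trace (outer v ** M) = (\<Sum>a\<in>UNIV. \<Sum>b\<in>UNIV. v $ a * v $ b * M $ b $ a)"
    by (simp add: outer_def trace_def matrix_matrix_mult_def)
  also have "\<dots> = (\<Sum>b\<in>UNIV. \<Sum>a\<in>UNIV. v $ a * v $ b * M $ b $ a)"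
    by (rule sum.swap)
  also have "\<dots> = v \<bullet> (M *v v)"
    by (simp add: inner_vec_def matrix_vector_mult_def sum_distrib_left mult_ac)
  finally show ?thesis .
qed

lemma mat_pow_add: "mat_pow A (i + j) = mat_pow A i ** mat_pow A j"
  by (induction i) (auto simp: matrix_mul_assoc)

subsection \<open>Diagonalisation of symmetric matrices\<close>

text \<open>Indexing by the coordinate type itself makes the number of vectors equal to the
  dimension, so such a family is automatically a basis.\<close>

definition orthonormal :: "('n \<Rightarrow> real^'n) \<Rightarrow> bool" where
  "orthonormal v \<longleftrightarrow> (\<forall>i j. v i \<bullet> v j = (if i = j then 1 else 0))"

definition eigenframe :: "real^'n^'n \<Rightarrow> ('n \<Rightarrow> real^'n) \<Rightarrow> ('n \<Rightarrow> real) \<Rightarrow> bool" where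
  "eigenframe A v d \<longleftrightarrow> orthonormal v \<and> (\<forall>i. A *v v i = d i *\<^sub>R v i)"

text \<open>With the vectors as columns of P, orthonormality reads P^T P = 1. A one-sided inverse of
  a square matrix is two-sided, and P P^T is the sum of the rank-one projections.\<close>

lemma sum_outer_orthonormal:
  assumes "orthonormal (v :: 'n \<Rightarrow> real^'n)"
  shows "(\<Sum>i\<in>UNIV. outer (v i)) = mat 1"
proof -
  define P :: "real^'n^'n" where "P = (\<chi> a i. v i $ a)"
  have "transpose P ** P = mat 1"
    using assms
    by (simp add: P_def orthonormal_def transpose_def matrix_matrix_mult_def mat_def vec_eq_iff inner_vec_def)
  then have "P ** transpose P = mat 1"
    using matrix_left_right_inverse by blast
  moreover have "P ** transpose P = (\<Sum>i\<in>UNIV. outer (v i))"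
    by (simp add: P_def outer_def transpose_def matrix_matrix_mult_def vec_eq_iff)
  ultimately show ?thesis
    by simp
qed

lemma orthonormal_expansion:
  assumes "orthonormal v"
  shows "x = (\<Sum>i\<in>UNIV. (v i \<bullet> x) *\<^sub>R v i)"
proof -
  have "x = (\<Sum>i\<in>UNIV. outer (v i)) *v x"
    by (simp add: sum_outer_orthonormal[OF assms])
  then show ?thesis
    by (simp add: matrix_vector_mult_sum_left outer_mult_vector)
qed

lemma orthonormal_parseval:
  assumes "orthonormal v"
  shows "x \<bullet> y = (\<Sum>i\<in>UNIV. (v i \<bullet> x) * (v i \<bullet> y))"
  by (subst orthonormal_expansion[OF assms, of y])
    (simp add: inner_sum_right inner_commute mult_ac)

lemma trace_orthonormal:
  assumes "orthonormal v"
  shows "trace M = (\<Sum>i\<in>UNIV. v i \<bullet> (M *v v i))"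
proof -
  have "trace M = trace ((\<Sum>i\<in>UNIV. outer (v i)) ** M)"
    by (simp add: sum_outer_orthonormal[OF assms])
  then show ?thesis
    by (simp add: matrix_mult.sum_left trace_sum trace_outer_mult)
qed

text \<open>A maximiser x of the Rayleigh quotient on the unit sphere of \<open>W\<close> is an
  eigenvector: invariance keeps the residual A x - l x in \<open>W\<close>, and moving x along a
  nonzero residual would increase the quotient.\<close>

lemma eigenvector_in_invariant_subspace:
  assumes A: "symmetric_mat (A :: real^'n^'n)" and W: "subspace W" "W \<noteq> {0}"
    and inv: "\<And>x. x \<in> W \<Longrightarrow> A *v x \<in> W"
  obtains x l where "x \<in> W" "norm x = 1" "A *v x = l *\<^sub>R x"
proof -
  let ?S = "W \<inter> sphere 0 1"
  obtain w where w: "w \<in> W" "w \<noteq> 0"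
    using W subspace_0 by blast
  then have "(1 / norm w) *\<^sub>R w \<in> ?S"
    using W by (auto simp: subspace_scale)
  then have "?S \<noteq> {}" by blast
  moreover have "compact ?S"
    by (metis W(1) closed_subspace compact_sphere closed_Int_compact)
  moreover have "continuous_on ?S (\<lambda>x. x \<bullet> (A *v x))"
    by (intro continuous_intros linear_continuous_on) auto
  ultimately obtain x where x: "x \<in> ?S" and max: "\<And>y. y \<in> ?S \<Longrightarrow> y \<bullet> (A *v y) \<le> x \<bullet> (A *v x)"
    using continuous_attains_sup[of ?S "\<lambda>x. x \<bullet> (A *v x)"] by metis
  define l where "l = x \<bullet> (A *v x)"
  have xW: "x \<in> W" and nx: "norm x = 1"
    using x by auto
  have xx: "x \<bullet> x = 1"
    using nx by (simp add: norm_eq_1)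
  have le: "y \<bullet> (A *v y) \<le> l * (y \<bullet> y)" if "y \<in> W" for y
  proof (cases "y = 0")
    case False
    let ?c = "1 / norm y"
    have "?c *\<^sub>R y \<in> ?S"
      using False that W by (auto simp: subspace_scale)
    from max[OF this] have "(y \<bullet> (A *v y)) / (norm y)\<^sup>2 \<le> l"
      by (simp add: l_def matrix_vector_mult_scaleR power2_eq_square)
    then show ?thesis
      using False by (simp add: field_simps dot_square_norm)
  qed simp
  define w where "w = A *v x - l *\<^sub>R x"
  have wW: "w \<in> W"
    unfolding w_def using W inv xW by (simp add: subspace_diff subspace_scale)
  define b where "b = w \<bullet> (A *v w) - l * (w \<bullet> w)"
  \<comment> \<open>This is \<open>le\<close> at x + t w, expanded in t. The terms l (w . x) cancel
    because w is the residual of x, which leaves w . w as the first-order coefficient.\<close>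
  have quad: "2 * t * (w \<bullet> w) + t\<^sup>2 * b \<le> 0" for t
  proof -
    have "x + t *\<^sub>R w \<in> W"
      using W xW wW by (simp add: subspace_add subspace_scale)
    from le[OF this]
    have "x \<bullet> (A *v x) + t * (x \<bullet> (A *v w)) + t * (w \<bullet> (A *v x)) + t * t * (w \<bullet> (A *v w))
        \<le> l * (x \<bullet> x + 2 * t * (w \<bullet> x) + t * t * (w \<bullet> w))"
      by (simp add: matrix_vector_right_distrib matrix_vector_mult_scaleR inner_simps inner_commute algebra_simps)
    moreover have "x \<bullet> (A *v w) = w \<bullet> (A *v x)"
      using symmetric_mat_inner[OF A, of x w] by (simp add: inner_commute)
    moreover have "w \<bullet> (A *v x) = w \<bullet> w + l * (w \<bullet> x)"
      by (metis (no_types) add.commute add_diff_cancel_left' diff_add_cancel inner_add_right inner_scaleR_right w_def)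
    moreover have "x \<bullet> (A *v x) = l"
      by (simp add: l_def)
    ultimately show ?thesis
      using xx by (simp add: b_def power2_eq_square algebra_simps)
  qed
  have "w \<bullet> w = 0"
  proof (rule ccontr)
    assume "w \<bullet> w \<noteq> 0"
    then have a: "w \<bullet> w > 0"
      by simp
    \<comment> \<open>Small enough that the linear term of \<open>quad\<close> dominates the
      quadratic one; the added 1 keeps the denominator positive when b = 0.\<close>
    define t where "t = (w \<bullet> w) / (\<bar>b\<bar> + 1)"
    have t: "t > 0"
      using a unfolding t_def by (simp add: add_nonneg_pos)
    have "t * \<bar>b\<bar> \<le> w \<bullet> w"
      using a by (simp add: t_def field_simps)
    moreover have "- (t * \<bar>b\<bar>) \<le> t * b"
      using t by (metis abs_ge_minus_self abs_mult abs_of_pos minus_le_iff)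
    ultimately have "0 < 2 * (w \<bullet> w) + t * b"
      using a by linarith
    then have "0 < t * (2 * (w \<bullet> w) + t * b)"
      using t by simp
    then show False
      using quad[of t] by (simp add: algebra_simps power2_eq_square)
  qed
  then have "A *v x = l *\<^sub>R x"
    by (simp add: w_def)
  then show thesis
    using that xW nx by blast
qed

text \<open>Take a largest orthonormal set of eigenvectors. By symmetry its orthogonal complement is
  invariant, so a nonzero complement would contain one more unit eigenvector.\<close>

lemma eigenframe_exists:
  assumes A: "symmetric_mat (A :: real^'n^'n)"
  obtains v d where "eigenframe A v d"
proof -
  define good where "good S \<longleftrightarrow> pairwise orthogonal S \<and> (\<forall>x\<in>S. norm x = 1 \<and> (\<exists>l. A *v x = l *\<^sub>R x))"
    for S :: "(real^'n) set"
  have indep: "independent S" if "good S" for S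
    using that pairwise_orthogonal_independent[of S] by (force simp: good_def)
  have bound: "finite S \<and> card S \<le> CARD('n)" if "good S" for S
    using independent_bound[OF indep[OF that]] by simp
  have "good {}"
    by (simp add: good_def)
  \<comment> \<open>A largest such set exists because orthonormal sets are independent and so have
    at most n elements.\<close>
  then obtain S where S: "good S" and maxS: "\<And>S'. good S' \<Longrightarrow> card S' \<le> card S"
    using ex_has_greatest_nat[of good "{}" card "Suc CARD('n)"] bound le_imp_less_Suc by metis
  define W where "W = {x. \<forall>y\<in>S. orthogonal y x}"
  have W: "subspace W"
    unfolding W_def subspace_def by (auto simp: orthogonal_clauses)
  have "A *v x \<in> W" if "x \<in> W" for x
  proof -
    have "orthogonal y (A *v x)" if y: "y \<in> S" for y
    proof -
      obtain l where "A *v y = l *\<^sub>R y"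
        using S y unfolding good_def by blast
      moreover have "y \<bullet> x = 0"
        using \<open>x \<in> W\<close> that by (auto simp: W_def orthogonal_def)
      ultimately show ?thesis
        by (simp add: orthogonal_def symmetric_mat_inner[OF A])
    qed
    then show ?thesis
      by (simp add: W_def)
  qed
  have "W = {0}"
  proof (rule ccontr)
    assume "W \<noteq> {0}"
    then obtain x l where x: "x \<in> W" "norm x = 1" "A *v x = l *\<^sub>R x"
      using eigenvector_in_invariant_subspace[OF A W] \<open>\<And>x. x \<in> W \<Longrightarrow> A *v x \<in> W\<close> by blast
    have "x \<notin> S"
      using x by (auto simp: W_def orthogonal_def)
    moreover have "good (insert x S)"
      using S x by (auto simp: good_def W_def pairwise_insert orthogonal_commute)
    ultimately show False
      using maxS[of "insert x S"] bound[OF S] by simp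
  qed
  have "span S = UNIV"
  proof (rule ccontr)
    assume "span S \<noteq> UNIV"
    then have "span S \<subset> span UNIV"
      by auto
    then obtain x where "x \<noteq> 0" "\<And>y. y \<in> span S \<Longrightarrow> orthogonal x y"
      using orthogonal_to_subspace_exists_gen[of S UNIV] by metis
    then have "x \<in> W"
      by (auto simp: W_def orthogonal_commute span_base)
    with \<open>W = {0}\<close> \<open>x \<noteq> 0\<close> show False
      by simp
  qed
  then have "card S = CARD('n)"
    using dim_eq_card_independent[OF indep[OF S]] dim_span[of S] by simp
  then obtain v where v: "bij_betw v (UNIV :: 'n set) S"
    using bound[OF S] finite_same_card_bij[of "UNIV :: 'n set" S] by auto
  have vS: "v i \<in> S" for i
    using v bij_betwE by blast
  have "orthonormal v"
  proof -
    have "v i \<bullet> v j = 0" if "i \<noteq> j" for i j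
      using S vS v that unfolding good_def pairwise_def bij_betw_def inj_def orthogonal_def by metis
    moreover have "v i \<bullet> v i = 1" for i
      using S vS by (simp add: good_def norm_eq_1)
    ultimately show ?thesis
      by (simp add: orthonormal_def)
  qed
  moreover have "\<forall>i. \<exists>l. A *v v i = l *\<^sub>R v i"
    using S vS by (auto simp: good_def)
  then obtain d where "\<And>i. A *v v i = d i *\<^sub>R v i"
    by metis
  ultimately show thesis
    using that by (auto simp: eigenframe_def)
qed


section \<open>Powers and the exponential in a fixed eigenframe\<close>

context
  fixes A :: "real^'n^'n" and v d
  assumes frame: "eigenframe A v d"
begin

lemma eigenframe_orthonormal: "orthonormal v"
  and eigenframe_eigen: "A *v v i = d i *\<^sub>R v i"
  using frame by (auto simp: eigenframe_def)

lemma mat_pow_eigenframe: "mat_pow A k = (\<Sum>i\<in>UNIV. d i ^ k *\<^sub>R outer (v i))"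
proof (induction k)
  case 0
  show ?case
    using sum_outer_orthonormal[OF eigenframe_orthonormal] by simp
next
  case (Suc k)
  have "A ** outer (v i) = d i *\<^sub>R outer (v i)" for i
  proof -
    have "(A ** outer (v i)) *v x = (d i *\<^sub>R outer (v i)) *v x" for x
      by (simp add: matrix_vector_mul_assoc[symmetric] outer_mult_vector matrix_vector_mult_scaleR
          eigenframe_eigen scaleR_matrix_vector_assoc[symmetric] mult_ac)
    then show ?thesis
      using matrix_eq by blast
  qed
  then show ?case
    by (simp add: Suc matrix_mult.sum_right matrix_mult.scaleR_right mult_ac)
qed

lemma trace_mat_pow_mult: "trace (mat_pow A k ** M) = (\<Sum>i\<in>UNIV. d i ^ k * (v i \<bullet> (M *v v i)))"
  by (simp add: mat_pow_eigenframe matrix_mult.sum_left matrix_mult.scaleR_left trace_sum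
      trace_scaleR trace_outer_mult)

text \<open>The \<open>suminf\<close> in \<open>mat_exp\<close> carries no convergence by itself;
  here convergence comes from the scalar exponential series at each eigenvalue.\<close>

lemma mat_exp_sums: "(\<lambda>k. (1 / fact k) *\<^sub>R mat_pow A k) sums (\<Sum>i\<in>UNIV. exp (d i) *\<^sub>R outer (v i))"
proof -
  have "(\<lambda>k. \<Sum>i\<in>UNIV. (d i ^ k /\<^sub>R fact k) *\<^sub>R outer (v i)) sums (\<Sum>i\<in>UNIV. exp (d i) *\<^sub>R outer (v i))"
    by (intro sums_sum sums_scaleR_left exp_converges)
  then show ?thesis
    by (simp add: mat_pow_eigenframe scaleR_sum_right divide_inverse mult_ac)
qed

lemma mat_exp_eigenframe: "mat_exp A = (\<Sum>i\<in>UNIV. exp (d i) *\<^sub>R outer (v i))"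
  unfolding mat_exp_def using mat_exp_sums by (rule sums_unique[symmetric])

lemma trace_mat_exp: "trace (mat_exp A) = (\<Sum>i\<in>UNIV. exp (d i))"
proof -
  have "trace (outer (v i)) = 1" for i
    using trace_outer_mult[of "v i" "mat 1"] eigenframe_orthonormal by (simp add: orthonormal_def)
  then show ?thesis
    by (simp add: mat_exp_eigenframe trace_sum trace_scaleR)
qed

text \<open>An eigenvector x has a nonzero coefficient along some \<open>v i\<close>; moving
  \<open>A\<close> across that inner product equates the two eigenvalues.\<close>

lemma eigenvalue_in_frame:
  assumes sym: "symmetric_mat A" and "eigenvalue A l"
  obtains i where "d i = l"
proof -
  obtain x where x: "x \<noteq> 0" "A *v x = l *\<^sub>R x"
    using assms by (auto simp: eigenvalue_def)
  then obtain i where i: "v i \<bullet> x \<noteq> 0"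
    using orthonormal_expansion[OF eigenframe_orthonormal, of x] by force
  have "d i * (v i \<bullet> x) = (A *v v i) \<bullet> x"
    by (simp add: eigenframe_eigen)
  also have "\<dots> = l * (v i \<bullet> x)"
    by (metis symmetric_mat_inner[OF sym] x(2) inner_scaleR_right)
  finally show thesis
    using that i by simp
qed

end

text \<open>Adding c times the identity keeps the eigenframe and raises every eigenvalue by
  c.\<close>

lemma mat_exp_shift:
  fixes A :: "real^'n^'n"
  assumes "symmetric_mat A"
  shows "mat_exp (A + mat c) = exp c *\<^sub>R mat_exp A"
proof -
  obtain v d where frame: "eigenframe A v d"
    using eigenframe_exists[OF assms] .
  have "eigenframe (A + mat c) v (\<lambda>i. d i + c)"
    by (simp add: eigenframe_def eigenframe_orthonormal[OF frame] eigenframe_eigen[OF frame]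
        mat_vector_mult matrix_vector_mult_add_rdistrib scaleR_add_left)
  then show ?thesis
    using mat_exp_eigenframe[OF frame]
    by (simp add: mat_exp_eigenframe exp_add scaleR_sum_right mult.commute)
qed


subsection \<open>A differential inequality for the trace exponential\<close>

lemma psd_inner_nonneg: "psd A \<Longrightarrow> 0 \<le> x \<bullet> (A *v x)"
  by (simp add: psd_def)

lemma psd_eigenframe_nonneg:
  assumes "psd A" "eigenframe A v d"
  shows "0 \<le> d i"
  using psd_inner_nonneg[OF assms(1), of "v i"] assms(2) by (simp add: eigenframe_def orthonormal_def)

text \<open>As quadratic forms this is B^2 <= tr(B) B: each eigenvalue is at most the sum of all of
  them, since none is negative.\<close>

lemma psd_norm_mult_le:
  assumes B: "psd (B :: real^'n^'n)"
  shows "(B *v x) \<bullet> (B *v x) \<le> trace B * (x \<bullet> (B *v x))"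
proof -
  have sym: "symmetric_mat B"
    using B by (simp add: psd_def)
  obtain v d where frame: "eigenframe B v d"
    using eigenframe_exists[OF sym] .
  note orth = eigenframe_orthonormal[OF frame] and eig = eigenframe_eigen[OF frame]
  have coord: "v i \<bullet> (B *v x) = d i * (v i \<bullet> x)" for i
    by (simp add: symmetric_mat_inner[OF sym] eig)
  have d: "0 \<le> d i" for i
    using psd_eigenframe_nonneg[OF B frame] .
  have "trace B = (\<Sum>i\<in>UNIV. d i)"
    using orth by (simp add: trace_orthonormal[OF orth] eig orthonormal_def)
  then have le: "d i \<le> trace B" for i
    using member_le_sum[of i UNIV d] d by simp
  have "(B *v x) \<bullet> (B *v x) = (\<Sum>i\<in>UNIV. d i * (d i * (v i \<bullet> x)\<^sup>2))"
    by (simp add: orthonormal_parseval[OF orth, of "B *v x"] coord power2_eq_square mult_ac)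
  also have "\<dots> \<le> (\<Sum>i\<in>UNIV. trace B * (d i * (v i \<bullet> x)\<^sup>2))"
    by (intro sum_mono mult_right_mono le mult_nonneg_nonneg d) auto
  also have "\<dots> = trace B * (x \<bullet> (B *v x))"
    by (simp add: orthonormal_parseval[OF orth, of x] coord power2_eq_square mult_ac sum_distrib_left)
  finally show ?thesis .
qed

text \<open>With a nonpositive trace, \<open>psd_norm_mult_le\<close> would force B x = 0 for every
  x. Positivity makes the divisions by tr B genuine.\<close>

lemma psd_trace_pos:
  assumes B: "psd B" and "B \<noteq> 0"
  shows "0 < trace B"
proof (rule ccontr)
  assume "\<not> 0 < trace B"
  moreover have "0 \<le> x \<bullet> (B *v x)" for x
    using psd_inner_nonneg[OF B] .
  ultimately have "(B *v x) \<bullet> (B *v x) \<le> 0" for x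
    using psd_norm_mult_le[OF B, of x] mult_nonpos_nonneg[of "trace B" "x \<bullet> (B *v x)"]
    by (meson linorder_not_less order_trans)
  then have "B *v x = 0 *v x" for x
    by (metis inner_eq_zero_iff inner_ge_zero matrix_vector_mult_0 order_antisym)
  then show False
    using \<open>B \<noteq> 0\<close> matrix_eq by blast
qed

lemma trace_mat_pow_mult_nonneg:
  assumes X: "psd X" and B: "psd B"
  shows "0 \<le> trace (B ** mat_pow X k)"
proof -
  obtain v d where frame: "eigenframe X v d"
    using eigenframe_exists X psd_def by metis
  have "trace (B ** mat_pow X k) = (\<Sum>i\<in>UNIV. d i ^ k * (v i \<bullet> (B *v v i)))"
    using trace_mat_pow_mult[OF frame] trace_mul_sym by metis
  then show ?thesis
    using psd_eigenframe_nonneg[OF X frame] psd_inner_nonneg[OF B]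
    by (simp add: sum_nonneg)
qed

text \<open>The differences x^i - y^i and x^l - y^l never have opposite signs, because powers are
  monotone on the nonnegative reals.\<close>

lemma power_mult_power_le:
  assumes "0 \<le> x" "0 \<le> (y::real)"
  shows "x ^ i * y ^ l + x ^ l * y ^ i \<le> x ^ (i + l) + y ^ (i + l)"
proof -
  have "0 \<le> (x ^ i - y ^ i) * (x ^ l - y ^ l)"
  proof (cases "x \<le> y")
    case True
    then show ?thesis
      using assms by (intro mult_nonpos_nonpos) (auto intro: power_mono)
  next
    case False
    then show ?thesis
      using assms by (intro mult_nonneg_nonneg) (auto intro: power_mono)
  qed
  then show ?thesis
    by (simp add: algebra_simps power_add)
qed

text \<open>In an eigenbasis of \<open>X\<close> with eigenvalues \<open>d\<close>, the left-hand side is the sum of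
  \<open>B\<^sub>a\<^sub>b\<^sup>2 d\<^sub>a\<^sup>i d\<^sub>b\<^sup>l\<close>, which may be symmetrised in \<open>a, b\<close>.\<close>
lemma trace_interlaced_powers_le:
  assumes X: "psd (X :: real^'n^'n)" and B: "symmetric_mat B"
  shows "trace (B ** mat_pow X i ** B ** mat_pow X l) \<le> trace (B ** B ** mat_pow X (i + l))"
proof -
  obtain v d where frame: "eigenframe X v d"
    using eigenframe_exists X psd_def by metis
  note orth = eigenframe_orthonormal[OF frame]
  have d: "0 \<le> d a" for a
    using psd_eigenframe_nonneg[OF X frame] .
  define b where "b p q = v p \<bullet> (B *v v q)" for p q
  have b_sym: "b p q = b q p" for p q
    unfolding b_def by (metis symmetric_mat_inner[OF B] inner_commute)
  have pow: "mat_pow X k *v x = (\<Sum>a\<in>UNIV. (d a ^ k * (v a \<bullet> x)) *\<^sub>R v a)" for k x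
    by (simp add: mat_pow_eigenframe[OF frame] matrix_vector_mult_sum_left
        scaleR_matrix_vector_assoc[symmetric] outer_mult_vector)
  have mid: "v p \<bullet> ((B ** mat_pow X i ** B) *v v p) = (\<Sum>q\<in>UNIV. d q ^ i * (b p q)\<^sup>2)" for p
  proof -
    have "v p \<bullet> ((B ** mat_pow X i ** B) *v v p) = (B *v v p) \<bullet> (mat_pow X i *v (B *v v p))"
      by (simp add: matrix_vector_mul_assoc[symmetric] symmetric_mat_inner[OF B])
    also have "\<dots> = (\<Sum>q\<in>UNIV. d q ^ i * (b q p)\<^sup>2)"
      by (simp add: pow inner_sum_right b_def power2_eq_square inner_commute mult_ac)
    finally show ?thesis
      by (simp add: b_sym[of p])
  qed
  have "trace (B ** mat_pow X i ** B ** mat_pow X l) = (\<Sum>p\<in>UNIV. d p ^ l * (v p \<bullet> ((B ** mat_pow X i ** B) *v v p)))"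
    using trace_mat_pow_mult[OF frame] trace_mul_sym by metis
  then have lhs: "trace (B ** mat_pow X i ** B ** mat_pow X l) = (\<Sum>p\<in>UNIV. \<Sum>q\<in>UNIV. (b p q)\<^sup>2 * (d p ^ l * d q ^ i))"
    by (simp add: mid sum_distrib_left mult_ac)
  also have "\<dots> = (\<Sum>p\<in>UNIV. \<Sum>q\<in>UNIV. (b q p)\<^sup>2 * (d q ^ l * d p ^ i))"
    by (rule sum.swap)
  finally have lhs': "trace (B ** mat_pow X i ** B ** mat_pow X l) = (\<Sum>p\<in>UNIV. \<Sum>q\<in>UNIV. (b p q)\<^sup>2 * (d p ^ i * d q ^ l))"
    by (simp add: b_sym mult_ac)
  have "v p \<bullet> ((B ** B) *v v p) = (\<Sum>q\<in>UNIV. (b p q)\<^sup>2)" for p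
  proof -
    have "v p \<bullet> ((B ** B) *v v p) = (B *v v p) \<bullet> (B *v v p)"
      by (simp add: matrix_vector_mul_assoc[symmetric] symmetric_mat_inner[OF B])
    also have "\<dots> = (\<Sum>q\<in>UNIV. (b q p)\<^sup>2)"
      by (simp add: orthonormal_parseval[OF orth, of "B *v v p"] b_def power2_eq_square)
    finally show ?thesis
      by (simp add: b_sym[of p])
  qed
  moreover have "trace (B ** B ** mat_pow X (i + l)) = (\<Sum>p\<in>UNIV. d p ^ (i + l) * (v p \<bullet> ((B ** B) *v v p)))"
    using trace_mat_pow_mult[OF frame] trace_mul_sym by metis
  ultimately have rhs: "trace (B ** B ** mat_pow X (i + l)) = (\<Sum>p\<in>UNIV. \<Sum>q\<in>UNIV. (b p q)\<^sup>2 * d p ^ (i + l))"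
    by (simp add: sum_distrib_left mult_ac)
  also have "\<dots> = (\<Sum>p\<in>UNIV. \<Sum>q\<in>UNIV. (b q p)\<^sup>2 * d q ^ (i + l))"
    by (rule sum.swap)
  finally have rhs': "trace (B ** B ** mat_pow X (i + l)) = (\<Sum>p\<in>UNIV. \<Sum>q\<in>UNIV. (b p q)\<^sup>2 * d q ^ (i + l))"
    by (simp add: b_sym)
  \<comment> \<open>Adding the two forms of each trace, one with p and q exchanged, makes both sides
    symmetric, so the scalar inequality applies to each pair of eigenvalues.\<close>
  have "2 * trace (B ** mat_pow X i ** B ** mat_pow X l)
      = (\<Sum>p\<in>UNIV. \<Sum>q\<in>UNIV. (b p q)\<^sup>2 * (d p ^ i * d q ^ l + d p ^ l * d q ^ i))"
    using lhs lhs' by (simp add: distrib_left sum.distrib)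
  also have "\<dots> \<le> (\<Sum>p\<in>UNIV. \<Sum>q\<in>UNIV. (b p q)\<^sup>2 * (d p ^ (i + l) + d q ^ (i + l)))"
    by (intro sum_mono mult_left_mono power_mult_power_le d) auto
  also have "\<dots> = 2 * trace (B ** B ** mat_pow X (i + l))"
    using rhs rhs' by (simp add: distrib_left sum.distrib)
  finally show ?thesis
    by simp
qed

text \<open>In an eigenframe of \<open>X\<close> both traces are sums of quadratic forms with the
  same nonnegative weights d^k, so \<open>psd_norm_mult_le\<close> compares them term by
  term.\<close>

lemma trace_square_mult_mat_pow_le:
  assumes X: "psd X" and B: "psd B"
  shows "trace (B ** B ** mat_pow X k) \<le> trace B * trace (B ** mat_pow X k)"
proof -
  obtain v d where frame: "eigenframe X v d"
    using eigenframe_exists X psd_def by metis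
  have sym: "symmetric_mat B"
    using B by (simp add: psd_def)
  have "trace (B ** B ** mat_pow X k) = (\<Sum>i\<in>UNIV. d i ^ k * (v i \<bullet> ((B ** B) *v v i)))"
    using trace_mat_pow_mult[OF frame] trace_mul_sym by metis
  also have "\<dots> \<le> (\<Sum>i\<in>UNIV. d i ^ k * (trace B * (v i \<bullet> (B *v v i))))"
  proof (intro sum_mono mult_left_mono)
    show "v i \<bullet> ((B ** B) *v v i) \<le> trace B * (v i \<bullet> (B *v v i))" for i
      using psd_norm_mult_le[OF B, of "v i"]
      by (simp add: matrix_vector_mul_assoc[symmetric] symmetric_mat_inner[OF sym])
  qed (simp add: psd_eigenframe_nonneg[OF X frame])
  also have "\<dots> = trace B * (\<Sum>i\<in>UNIV. d i ^ k * (v i \<bullet> (B *v v i)))"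
    by (simp add: sum_distrib_left mult_ac)
  also have "\<dots> = trace B * trace (B ** mat_pow X k)"
    using trace_mat_pow_mult[OF frame] trace_mul_sym by metis
  finally show ?thesis .
qed

section \<open>Derivatives of matrix powers and Taylor polynomials along a line\<close>

lemma has_vector_derivative_mat_pow:
  "((\<lambda>r. mat_pow (H + r *\<^sub>R B) k) has_vector_derivative
     (\<Sum>i<k. mat_pow (H + s *\<^sub>R B) i ** B ** mat_pow (H + s *\<^sub>R B) (k - 1 - i))) (at s)"
proof (induction k)
  case (Suc k)
  let ?X = "H + s *\<^sub>R B"
  have "((\<lambda>r. H + r *\<^sub>R B) has_vector_derivative B) (at s)"
    by (auto intro!: derivative_eq_intros)
  from matrix_mult.has_vector_derivative[OF this Suc]
  have "((\<lambda>r. mat_pow (H + r *\<^sub>R B) (Suc k)) has_vector_derivative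
     ?X ** (\<Sum>i<k. mat_pow ?X i ** B ** mat_pow ?X (k - 1 - i)) + B ** mat_pow ?X k) (at s)"
    by simp
  \<comment> \<open>Since \<open>B\<close> need not commute with \<open>?X\<close>, its position is
    recorded: differentiating the first factor gives the term i = 0, and the induction hypothesis
    gives the others.\<close>
  moreover have "?X ** (\<Sum>i<k. mat_pow ?X i ** B ** mat_pow ?X (k - 1 - i)) + B ** mat_pow ?X k
      = (\<Sum>i<Suc k. mat_pow ?X i ** B ** mat_pow ?X (Suc k - 1 - i))"
    by (simp only: sum.lessThan_Suc_shift) (simp add: matrix_mult.sum_right matrix_mul_assoc)
  ultimately show ?case
    by (simp only:)
qed simp

lemma has_real_derivative_trace_mult_mat_pow:
  "((\<lambda>r. trace (C ** mat_pow (H + r *\<^sub>R B) k)) has_real_derivative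
     (\<Sum>i<k. trace (C ** mat_pow (H + s *\<^sub>R B) i ** B ** mat_pow (H + s *\<^sub>R B) (k - 1 - i)))) (at s)"
  using bounded_linear.has_vector_derivative[OF bounded_linear_compose[OF bounded_linear_trace
      matrix_mult.bounded_linear_right[of C]] has_vector_derivative_mat_pow[of H B k s]]
  by (simp add: has_real_derivative_iff_has_vector_derivative matrix_mult.sum_right trace_sum matrix_mul_assoc)

text \<open>Taking \<open>C\<close> as \<open>mat 1\<close> differentiates the Taylor polynomial of
  the trace exponential once; taking \<open>C\<close> as \<open>B\<close> differentiates it a second
  time. The constant term k = 0 drops out, so the derivative has one term fewer.\<close>

lemma has_real_derivative_partial_trace_exp:
  "((\<lambda>r. \<Sum>k<Suc N. trace (C ** mat_pow (H + r *\<^sub>R B) k) / fact k) has_real_derivative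
     (\<Sum>k<N. (\<Sum>i\<le>k. trace (C ** mat_pow (H + s *\<^sub>R B) i ** B ** mat_pow (H + s *\<^sub>R B) (k - i))) / fact (Suc k))) (at s)"
proof -
  have "((\<lambda>r. trace (C ** mat_pow (H + r *\<^sub>R B) (Suc k)) / fact (Suc k)) has_real_derivative
     (\<Sum>i\<le>k. trace (C ** mat_pow (H + s *\<^sub>R B) i ** B ** mat_pow (H + s *\<^sub>R B) (k - i))) / fact (Suc k)) (at s)" for k
    using DERIV_cdivide[OF has_real_derivative_trace_mult_mat_pow[of C H B "Suc k" s], of "fact (Suc k)"]
    by (simp only: lessThan_Suc_atMost diff_Suc_1)
  then have "((\<lambda>r. \<Sum>k<N. trace (C ** mat_pow (H + r *\<^sub>R B) (Suc k)) / fact (Suc k)) has_real_derivative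
     (\<Sum>k<N. (\<Sum>i\<le>k. trace (C ** mat_pow (H + s *\<^sub>R B) i ** B ** mat_pow (H + s *\<^sub>R B) (k - i))) / fact (Suc k))) (at s)"
    by (intro DERIV_sum)
  from DERIV_add[OF DERIV_const[of "trace C"] this] show ?thesis
    by (simp only: sum.lessThan_Suc_shift) simp
qed

lemma of_nat_Suc_mult_divide_fact: "real (Suc k) * x / fact (Suc k) = x / fact k"
  by (simp del: of_nat_Suc)

text \<open>A Gronwall argument: exp(-r \<tau>) f1(r) is nonincreasing, so f1(r) lies below exp(r
  \<tau>) f1(0) to the right of 0 and above it to the left. Reversing the direction of integration
  for negative s gives the same bound on f(s).\<close>

lemma exp_growth_comparison:
  fixes f f1 f2 :: "real \<Rightarrow> real"
  assumes "0 < \<tau>"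
    and f: "\<And>r. r \<in> closed_segment 0 s \<Longrightarrow> (f has_real_derivative f1 r) (at r)"
    and f1: "\<And>r. r \<in> closed_segment 0 s \<Longrightarrow> (f1 has_real_derivative f2 r) (at r)"
    and le: "\<And>r. r \<in> closed_segment 0 s \<Longrightarrow> f2 r \<le> \<tau> * f1 r"
  shows "f s \<le> f 0 + (exp (s * \<tau>) - 1) / \<tau> * f1 0"
proof -
  define h where "h r = exp (- (r * \<tau>)) * f1 r" for r
  \<comment> \<open>Subtracts the integral of exp(r \<tau>) f1(0), which vanishes at 0; the claim
    becomes g(s) <= g(0).\<close>
  define g where "g r = f r - (exp (r * \<tau>) - 1) / \<tau> * f1 0" for r
  have h': "(h has_real_derivative exp (- (r * \<tau>)) * (f2 r - \<tau> * f1 r)) (at r)"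
    if "r \<in> closed_segment 0 s" for r
    unfolding h_def by (auto intro!: derivative_eq_intros f1 that simp: algebra_simps)
  have h'_le: "exp (- (r * \<tau>)) * (f2 r - \<tau> * f1 r) \<le> 0" if "r \<in> closed_segment 0 s" for r
    using le[OF that] by (simp add: mult_nonneg_nonpos)
  have g': "(g has_real_derivative exp (r * \<tau>) * (h r - h 0)) (at r)"
    if "r \<in> closed_segment 0 s" for r
  proof -
    have "(g has_real_derivative f1 r - exp (r * \<tau>) * f1 0) (at r)"
      unfolding g_def using \<open>0 < \<tau>\<close> by (auto intro!: derivative_eq_intros f that)
    then show ?thesis
      by (simp add: h_def right_diff_distrib mult.assoc[symmetric] exp_add[symmetric])
  qed
  have "g s \<le> g 0"
  proof (cases "0 \<le> s")
    case True
    then have seg: "closed_segment 0 s = {0..s}"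
      by (simp add: closed_segment_eq_real_ivl)
    have "h r \<le> h 0" if "0 \<le> r" "r \<le> s" for r
      using that h' h'_le unfolding seg
      by (intro DERIV_nonpos_imp_nonincreasing[of 0 r h]) (auto, meson order_trans)
    then have "\<exists>y. (g has_real_derivative y) (at r) \<and> y \<le> 0" if "0 \<le> r" "r \<le> s" for r
      using that g'[of r] unfolding seg by (intro exI conjI) (auto simp: mult_nonneg_nonpos)
    then show ?thesis
      using DERIV_nonpos_imp_nonincreasing[OF True] by blast
  next
    case False
    then have seg: "closed_segment 0 s = {s..0}"
      by (simp add: closed_segment_eq_real_ivl)
    \<comment> \<open>To the left of 0 the comparison is reversed, so g increases up to 0 and again
      g(s) <= g(0).\<close>
    have "h 0 \<le> h r" if "s \<le> r" "r \<le> 0" for r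
      using that h' h'_le unfolding seg
      by (intro DERIV_nonpos_imp_nonincreasing[of r 0 h]) (auto, meson order_trans)
    then have "\<exists>y. (g has_real_derivative y) (at r) \<and> 0 \<le> y" if "s \<le> r" "r \<le> 0" for r
      using that g'[of r] unfolding seg by (intro exI conjI) auto
    then show ?thesis
      using DERIV_nonneg_imp_nondecreasing[of s 0 g] False by force
  qed
  then show ?thesis
    by (simp add: g_def)
qed

text \<open>The differential inequality is proved degree by degree, and the power inequalities
  require nonnegative eigenvalues; hence semidefiniteness along the whole segment. The lengths N + 2
  and N + 1 reflect the term lost in each differentiation.\<close>

lemma partial_trace_exp_le:
  assumes B: "psd B" and pos: "0 < trace B"
    and X: "\<And>r. r \<in> closed_segment 0 s \<Longrightarrow> psd (H + r *\<^sub>R B)"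
  shows "(\<Sum>k<Suc (Suc N). trace (mat_pow (H + s *\<^sub>R B) k) / fact k) \<le>
    (\<Sum>k<Suc (Suc N). trace (mat_pow H k) / fact k) +
    (exp (s * trace B) - 1) / trace B * (\<Sum>k<Suc N. trace (B ** mat_pow H k) / fact k)"
proof -
  define f where "f r = (\<Sum>k<Suc (Suc N). trace (mat_pow (H + r *\<^sub>R B) k) / fact k)" for r
  define f1 where "f1 r = (\<Sum>k<Suc N. trace (B ** mat_pow (H + r *\<^sub>R B) k) / fact k)" for r
  define f2 where "f2 r = (\<Sum>k<N. (\<Sum>i\<le>k. trace (B ** mat_pow (H + r *\<^sub>R B) i ** B **
    mat_pow (H + r *\<^sub>R B) (k - i))) / fact (Suc k))" for r
  have "(f has_real_derivative f1 r) (at r)" for r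
  proof -
    let ?X = "H + r *\<^sub>R B"
    \<comment> \<open>Cyclicity of the trace makes all k + 1 terms equal to tr(B X^k), and the
      factor k + 1 cancels against the factorial.\<close>
    have "trace (mat_pow ?X i ** B ** mat_pow ?X (k - i)) = trace (B ** mat_pow ?X k)" if "i \<le> k" for i k
      using that trace_mul_sym[of "mat_pow ?X i" "B ** mat_pow ?X (k - i)"]
      by (simp add: matrix_mul_assoc[symmetric] mat_pow_add[symmetric])
    then have "(\<Sum>i\<le>k. trace (mat_pow ?X i ** B ** mat_pow ?X (k - i))) / fact (Suc k)
        = trace (B ** mat_pow ?X k) / fact k" for k
      using of_nat_Suc_mult_divide_fact[of k "trace (B ** mat_pow ?X k)"]
      by (simp del: fact_Suc of_nat_Suc)
    then show ?thesis
      using has_real_derivative_partial_trace_exp[of "mat 1" H B "Suc N" r]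
      by (simp only: matrix_mul_lid f_def[abs_def] f1_def)
  qed
  moreover have "(f1 has_real_derivative f2 r) (at r)" for r
    unfolding f1_def f2_def by (rule has_real_derivative_partial_trace_exp)
  moreover have "f2 r \<le> trace B * f1 r" if "r \<in> closed_segment 0 s" for r
  proof -
    let ?X = "H + r *\<^sub>R B"
    note X = X[OF that]
    have sym: "symmetric_mat B"
      using B by (simp add: psd_def)
    have "(\<Sum>i\<le>k. trace (B ** mat_pow ?X i ** B ** mat_pow ?X (k - i))) / fact (Suc k)
        \<le> trace B * (trace (B ** mat_pow ?X k) / fact k)" for k
    proof -
      have "(\<Sum>i\<le>k. trace (B ** mat_pow ?X i ** B ** mat_pow ?X (k - i)))
          \<le> (\<Sum>i\<le>k. trace B * trace (B ** mat_pow ?X k))"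
      proof (rule sum_mono)
        fix i assume "i \<in> {..k}"
        then show "trace (B ** mat_pow ?X i ** B ** mat_pow ?X (k - i)) \<le> trace B * trace (B ** mat_pow ?X k)"
          using trace_interlaced_powers_le[OF X sym, of i "k - i"]
            trace_square_mult_mat_pow_le[OF X B, of k] by simp
      qed
      then have "(\<Sum>i\<le>k. trace (B ** mat_pow ?X i ** B ** mat_pow ?X (k - i))) / fact (Suc k)
          \<le> real (Suc k) * (trace B * trace (B ** mat_pow ?X k)) / fact (Suc k)"
        by (intro divide_right_mono) (simp_all del: fact_Suc of_nat_Suc)
      then show ?thesis
        by (simp only: of_nat_Suc_mult_divide_fact times_divide_eq_right)
    qed
    then have "f2 r \<le> (\<Sum>k<N. trace B * (trace (B ** mat_pow ?X k) / fact k))"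
      unfolding f2_def by (rule sum_mono)
    \<comment> \<open>\<open>f1\<close> has one more term than \<open>f2\<close>; this extra term of
      top degree is nonnegative.\<close>
    also have "\<dots> \<le> (\<Sum>k<Suc N. trace B * (trace (B ** mat_pow ?X k) / fact k))"
      using pos trace_mat_pow_mult_nonneg[OF X B, of N] by simp
    finally show ?thesis
      by (simp only: f1_def sum_distrib_left)
  qed
  ultimately have "f s \<le> f 0 + (exp (s * trace B) - 1) / trace B * f1 0"
    using exp_growth_comparison[OF pos, of s f f1 f2] by blast
  then show ?thesis
    by (simp add: f_def f1_def)
qed

section \<open>From Taylor polynomials to the exponential\<close>

lemma trace_mult_mat_exp_sums:
  fixes A C :: "real^'n^'n"
  assumes "symmetric_mat A"
  shows "(\<lambda>k. trace (C ** mat_pow A k) / fact k) sums trace (C ** mat_exp A)"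
proof -
  obtain v d where frame: "eigenframe A v d"
    using eigenframe_exists[OF assms] .
  have "(\<lambda>k. (1 / fact k) *\<^sub>R mat_pow A k) sums mat_exp A"
    using mat_exp_sums[OF frame] mat_exp_eigenframe[OF frame] by simp
  from bounded_linear.sums[OF bounded_linear_compose[OF bounded_linear_trace
      matrix_mult.bounded_linear_right[of C]] this]
  show ?thesis
    by (simp add: matrix_mult.scaleR_right trace_scaleR)
qed

lemma trace_mat_exp_le_psd:
  fixes H B :: "real^'n^'n"
  assumes B: "psd B" and pos: "0 < trace B"
    and X: "\<And>r. r \<in> closed_segment 0 s \<Longrightarrow> psd (H + r *\<^sub>R B)"
  shows "trace (mat_exp (H + s *\<^sub>R B)) \<le>
    trace (mat_exp H) + (exp (s * trace B) - 1) / trace B * trace (B ** mat_exp H)"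
proof -
  have lim: "(\<lambda>N. \<Sum>k<N. trace (C ** mat_pow (H + r *\<^sub>R B) k) / fact k) \<longlonglongrightarrow> trace (C ** mat_exp (H + r *\<^sub>R B))"
    if "r \<in> closed_segment 0 s" for r and C :: "real^'n^'n"
    using trace_mult_mat_exp_sums X[OF that] unfolding psd_def sums_def by blast
  show ?thesis
  proof (rule LIMSEQ_le)
    show "(\<lambda>N. \<Sum>k<Suc (Suc N). trace (mat_pow (H + s *\<^sub>R B) k) / fact k) \<longlonglongrightarrow> trace (mat_exp (H + s *\<^sub>R B))"
      using LIMSEQ_Suc[OF LIMSEQ_Suc[OF lim[of s "mat 1"]]] by simp
    show "(\<lambda>N. (\<Sum>k<Suc (Suc N). trace (mat_pow H k) / fact k) +
        (exp (s * trace B) - 1) / trace B * (\<Sum>k<Suc N. trace (B ** mat_pow H k) / fact k))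
      \<longlonglongrightarrow> trace (mat_exp H) + (exp (s * trace B) - 1) / trace B * trace (B ** mat_exp H)"
      using LIMSEQ_Suc[OF LIMSEQ_Suc[OF lim[of 0 "mat 1"]]] LIMSEQ_Suc[OF lim[of 0 B]]
      by (intro tendsto_intros) (simp_all del: sum.lessThan_Suc)
  qed (use partial_trace_exp_le[OF B pos X] in blast)
qed

text \<open>This replaces the Golden--Thompson inequality followed by the convexity bound for
  \<open>exp (s B)\<close>. Shifting \<open>H\<close> by a multiple of the identity reduces it to the semidefinite case.\<close>
lemma trace_mat_exp_le:
  fixes H B :: "real^'n^'n"
  assumes H: "symmetric_mat H" and B: "psd B" and "B \<noteq> 0"
  shows "trace (mat_exp (H + s *\<^sub>R B)) \<le>
    trace (mat_exp H) + (exp (s * trace B) - 1) / trace B * trace (mat_exp H ** B)"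
proof -
  have sym: "symmetric_mat (H + r *\<^sub>R B)" for r
    using B H by (simp add: psd_def symmetric_mat_add symmetric_mat_scaleR)
  \<comment> \<open>Operator norms bound the quadratic forms of \<open>H\<close> and r
    \<open>B\<close> for |r| <= |s|, so a shift by this c makes the whole segment
    semidefinite.\<close>
  define c where "c = onorm ((*v) H) + \<bar>s\<bar> * onorm ((*v) B)"
  have bound: "\<bar>x \<bullet> (M *v x)\<bar> \<le> onorm ((*v) M) * (x \<bullet> x)" for x and M :: "real^'n^'n"
  proof -
    have "\<bar>x \<bullet> (M *v x)\<bar> \<le> norm x * norm (M *v x)"
      by (rule Cauchy_Schwarz_ineq2)
    also have "\<dots> \<le> norm x * (onorm ((*v) M) * norm x)"
      by (intro mult_left_mono onorm) auto
    finally show ?thesis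
      by (simp add: dot_square_norm power2_eq_square mult_ac)
  qed
  have "psd (H + mat c + r *\<^sub>R B)" if "r \<in> closed_segment 0 s" for r
  proof -
    have r: "\<bar>r\<bar> \<le> \<bar>s\<bar>"
      using that by (auto simp: closed_segment_eq_real_ivl split: if_splits)
    have "0 \<le> x \<bullet> ((H + mat c + r *\<^sub>R B) *v x)" for x
    proof -
      have "\<bar>r * (x \<bullet> (B *v x))\<bar> \<le> \<bar>s\<bar> * (onorm ((*v) B) * (x \<bullet> x))"
        unfolding abs_mult by (intro mult_mono r bound) auto
      then have "0 \<le> x \<bullet> (H *v x) + r * (x \<bullet> (B *v x)) + c * (x \<bullet> x)"
        using bound[of x H] by (simp add: c_def algebra_simps)
      then show ?thesis
        by (simp add: matrix_vector_mult_add_rdistrib inner_add_right mat_vector_mult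
            scaleR_matrix_vector_assoc[symmetric])
    qed
    moreover have "symmetric_mat (H + mat c + r *\<^sub>R B)"
      using symmetric_mat_add[OF sym symmetric_mat_mat, of r c] by (simp add: algebra_simps)
    ultimately show ?thesis
      by (simp add: psd_def)
  qed
  from trace_mat_exp_le_psd[OF B psd_trace_pos[OF B \<open>B \<noteq> 0\<close>] this]
  have "trace (mat_exp ((H + s *\<^sub>R B) + mat c)) \<le> trace (mat_exp (H + mat c))
      + (exp (s * trace B) - 1) / trace B * trace (mat_exp (H + mat c) ** B)"
    by (simp only: trace_mul_sym[of B] add.assoc add.commute[of "mat c"])
  \<comment> \<open>The shift multiplies every trace by the same positive factor exp(c), which
    cancels.\<close>
  then have "exp c * trace (mat_exp (H + s *\<^sub>R B)) \<le> exp c * (trace (mat_exp H)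
      + (exp (s * trace B) - 1) / trace B * trace (mat_exp H ** B))"
    by (simp add: mat_exp_shift[OF sym] mat_exp_shift[OF H] trace_scaleR matrix_mult.scaleR_left distrib_left mult_ac)
  then show ?thesis
    by simp
qed

subsection \<open>The iteration\<close>

lemma trace_mat_exp_pos:
  fixes A :: "real^'n^'n"
  assumes "symmetric_mat A"
  shows "0 < trace (mat_exp A)"
  using eigenframe_exists[OF assms] trace_mat_exp by (metis UNIV_not_empty exp_gt_zero finite sum_pos)

text \<open>The trace is the sum of the exponentials of all eigenvalues, and every summand is
  positive.\<close>

lemma exp_eigenvalue_le_trace_mat_exp:
  fixes A :: "real^'n^'n"
  assumes A: "symmetric_mat A" and "eigenvalue A l"
  shows "exp l \<le> trace (mat_exp A)"
proof -
  obtain v d where frame: "eigenframe A v d"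
    using eigenframe_exists[OF A] .
  obtain i where "d i = l"
    using eigenvalue_in_frame[OF frame A assms(2)] .
  then show ?thesis
    using member_le_sum[of i UNIV "\<lambda>i. exp (d i)"] trace_mat_exp[OF frame] by simp
qed

lemma mat_exp_0: "mat_exp 0 = (mat 1 :: real^'n^'n)"
proof -
  have "mat_pow 0 k = (if k = 0 then mat 1 else (0 :: real^'n^'n))" for k
    by (cases k) auto
  then have "mat_exp 0 = (\<Sum>k. if k = 0 then mat 1 else (0 :: real^'n^'n))"
    unfolding mat_exp_def by (intro arg_cong[where f = suminf]) auto
  also have "\<dots> = mat 1"
    using sums_single[of 0 "\<lambda>_. mat 1 :: real^'n^'n"] by (simp add: sums_iff)
  finally show ?thesis .
qed

text \<open>The signed parameters treat both bounds at once: \<sigma> = \<gamma>, \<delta> =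
  \<delta>U for the upper one and \<sigma> = -\<gamma>, \<delta> = -\<delta>L for the lower one. The
  first conclusion ensures that the logarithm is taken at a positive number; in the second case it
  says \<delta>L < 1.\<close>

lemma eigenvalue_bound_of_trace_exp_growth:
  fixes A :: "nat \<Rightarrow> real^'n^'n" and C :: "nat \<Rightarrow> real^'n^'n"
  assumes "0 < T"
    and A: "\<And>t. t \<le> T \<Longrightarrow> symmetric_mat (A t)"
    and A0: "A 0 = 0"
    and A_Suc: "\<And>t. t < T \<Longrightarrow> A (Suc t) = A t + \<alpha> t *\<^sub>R C t"
    and C: "\<And>t. t < T \<Longrightarrow> psd (C t) \<and> C t \<noteq> 0"
    and step: "\<And>t. t < T \<Longrightarrow>
      (exp (\<sigma> * \<alpha> t * trace (C t)) - 1) / trace (C t) *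
        trace_inner ((1 / trace (mat_exp (\<sigma> *\<^sub>R A t))) *\<^sub>R mat_exp (\<sigma> *\<^sub>R A t)) (C t) \<le> \<delta>"
    and l: "eigenvalue ((1 / real T) *\<^sub>R A T) l"
  shows "0 < 1 + \<delta>" and "\<sigma> * (real T * l) \<le> ln (real CARD('n)) + real T * ln (1 + \<delta>)"
proof -
  define \<phi> where "\<phi> t = trace (mat_exp (\<sigma> *\<^sub>R A t))" for t
  have pos: "0 < \<phi> t" if "t \<le> T" for t
    unfolding \<phi>_def using A[OF that] by (intro trace_mat_exp_pos symmetric_mat_scaleR)
  have \<phi>_Suc: "\<phi> (Suc t) \<le> (1 + \<delta>) * \<phi> t" if "t < T" for t
  proof -
    let ?W = "mat_exp (\<sigma> *\<^sub>R A t)"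
    have "\<phi> (Suc t) \<le> \<phi> t + (exp (\<sigma> * \<alpha> t * trace (C t)) - 1) / trace (C t) * trace (?W ** C t)"
      using trace_mat_exp_le[of "\<sigma> *\<^sub>R A t" "C t" "\<sigma> * \<alpha> t"] C[OF that] A[of t] that
      by (simp add: \<phi>_def A_Suc scaleR_add_right symmetric_mat_scaleR)
    \<comment> \<open>Dividing and multiplying by \<phi>(t) brings in the matrix of trace one that
      occurs in \<open>step\<close>.\<close>
    also have "\<dots> = \<phi> t + (exp (\<sigma> * \<alpha> t * trace (C t)) - 1) / trace (C t) *
        trace_inner ((1 / \<phi> t) *\<^sub>R ?W) (C t) * \<phi> t"
      using pos[of t] that by (simp add: trace_inner_def matrix_mult.scaleR_left trace_scaleR)
    also have "\<dots> \<le> \<phi> t + \<delta> * \<phi> t"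
      using step[OF that] pos[of t] that unfolding \<phi>_def[symmetric]
      by (intro add_left_mono mult_right_mono) auto
    finally show ?thesis
      by (simp add: algebra_simps)
  qed
  show "0 < 1 + \<delta>"
  proof -
    \<comment> \<open>One step of the iteration suffices: \<phi>(1) is positive and at most (1 +
      \<delta>) \<phi>(0). Such a step exists because 0 < T.\<close>
    have "0 < (1 + \<delta>) * \<phi> 0"
      using \<phi>_Suc[of 0] pos[of 1] \<open>0 < T\<close> by simp
    then show ?thesis
      using pos[of 0] by (simp add: zero_less_mult_iff)
  qed
  have "\<phi> t \<le> real CARD('n) * (1 + \<delta>) ^ t" if "t \<le> T" for t
    using that
  proof (induction t)
    case 0
    show ?case
      by (simp add: \<phi>_def A0 mat_exp_0 trace_I)
  next
    case (Suc t)
    then have "\<phi> (Suc t) \<le> (1 + \<delta>) * (real CARD('n) * (1 + \<delta>) ^ t)"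
      using \<phi>_Suc[of t] \<open>0 < 1 + \<delta>\<close> by (meson Suc_le_lessD less_imp_le mult_left_mono order_trans)
    then show ?case
      by (simp add: mult_ac)
  qed
  moreover have "eigenvalue (\<sigma> *\<^sub>R A T) (\<sigma> * (real T * l))"
  proof -
    obtain x where "x \<noteq> 0" "(1 / real T) *\<^sub>R (A T *v x) = l *\<^sub>R x"
      using l by (auto simp: eigenvalue_def scaleR_matrix_vector_assoc)
    then have "real T *\<^sub>R ((1 / real T) *\<^sub>R (A T *v x)) = real T *\<^sub>R (l *\<^sub>R x)"
      by simp
    then have "A T *v x = (real T * l) *\<^sub>R x"
      using \<open>0 < T\<close> by simp
    with \<open>x \<noteq> 0\<close> show ?thesis
      by (auto simp: eigenvalue_def scaleR_matrix_vector_assoc[symmetric])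
  qed
  then have "exp (\<sigma> * (real T * l)) \<le> \<phi> T"
    unfolding \<phi>_def using A by (intro exp_eigenvalue_le_trace_mat_exp symmetric_mat_scaleR) auto
  ultimately have "exp (\<sigma> * (real T * l)) \<le> real CARD('n) * (1 + \<delta>) ^ T"
    by fastforce
  then have "\<sigma> * (real T * l) \<le> ln (real CARD('n) * (1 + \<delta>) ^ T)"
    using \<open>0 < 1 + \<delta>\<close> by (subst ln_ge_iff) auto
  then show "\<sigma> * (real T * l) \<le> ln (real CARD('n)) + real T * ln (1 + \<delta>)"
    using \<open>0 < 1 + \<delta>\<close> by (simp add: ln_mult ln_realpow)
qed

theorem theorem6p1:
  fixes T m :: nat
    and B :: "nat \<Rightarrow> real^'n^'n"
    and \<gamma> \<eta> \<delta>L \<delta>U :: real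
    and A WL WU :: "nat \<Rightarrow> real^'n^'n"
    and \<alpha> :: "nat \<Rightarrow> real"
    and j :: "nat \<Rightarrow> nat"
  assumes "0 < T"
    and "\<And>i. i \<in> {1..m} \<Longrightarrow> psd (B i)"
    and "\<And>i. i \<in> {1..m} \<Longrightarrow> B i \<noteq> 0"
    and "0 < \<gamma>" and "0 < \<eta>" and "0 < \<delta>L" and "0 < \<delta>U"
    and "\<And>t. t \<in> {0..T+1} \<Longrightarrow>
           symmetric_mat (A t) \<and> symmetric_mat (WL t) \<and> symmetric_mat (WU t)"
    and "\<And>t. t \<in> {0..T+1} \<Longrightarrow> 0 \<le> \<alpha> t \<and> j t \<in> {1..m}"
    and "\<And>t. t \<in> {0..T} \<Longrightarrow> A t = (\<Sum>\<tau>=1..t. \<alpha> \<tau> *\<^sub>R B (j \<tau>))"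
    and "\<And>t. t \<in> {0..T} \<Longrightarrow> WU (t+1) = mat_exp (\<gamma> *\<^sub>R A t)"
    and "\<And>t. t \<in> {0..T} \<Longrightarrow> WL (t+1) = mat_exp ((- \<gamma>) *\<^sub>R A t)"
    and "\<And>t. t \<in> {1..T} \<Longrightarrow>
           solves_system \<gamma> \<delta>L \<delta>U m B
             ((1 / trace (WL t)) *\<^sub>R WL t) ((1 / trace (WU t)) *\<^sub>R WU t) (\<alpha> t) (j t)"
  shows "\<forall>l. eigenvalue ((1 / real T) *\<^sub>R A T) l \<longrightarrow>
           ln (inverse (1 - \<delta>L)) / \<gamma> - ln (real CARD('n)) / (real T * \<gamma>) \<le> l \<and>
           l \<le> ln (1 + \<delta>U) / \<gamma> + ln (real CARD('n)) / (real T * \<gamma>)"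
proof (intro allI impI)
  fix l
  assume l: "eigenvalue ((1 / real T) *\<^sub>R A T) l"
  \<comment> \<open>The growth lemma counts steps from 0, so its step t is step t + 1 here; the
    weights at t + 1 are the exponentials of multiples of A(t).\<close>
  let ?C = "\<lambda>t. B (j (Suc t))"
  have A: "symmetric_mat (A t)" if "t \<le> T" for t
    using assms(8)[of t] that by simp
  have A0: "A 0 = 0"
    using assms(10)[of 0] by simp
  have A_Suc: "A (Suc t) = A t + \<alpha> (Suc t) *\<^sub>R ?C t" if "t < T" for t
    using assms(10)[of t] assms(10)[of "Suc t"] that by simp
  have C: "psd (?C t) \<and> ?C t \<noteq> 0" if "t < T" for t
    using assms(9)[of "Suc t"] assms(2,3) that by simp
  have sol: "solves_system \<gamma> \<delta>L \<delta>U m B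
      ((1 / trace (mat_exp ((- \<gamma>) *\<^sub>R A t))) *\<^sub>R mat_exp ((- \<gamma>) *\<^sub>R A t))
      ((1 / trace (mat_exp (\<gamma> *\<^sub>R A t))) *\<^sub>R mat_exp (\<gamma> *\<^sub>R A t)) (\<alpha> (Suc t)) (j (Suc t))"
    if "t < T" for t
    using assms(13)[of "Suc t"] assms(11)[of t] assms(12)[of t] that by simp
  have U: "\<gamma> * (real T * l) \<le> ln (real CARD('n)) + real T * ln (1 + \<delta>U)"
    using eigenvalue_bound_of_trace_exp_growth(2)[OF assms(1) A A0 A_Suc C _ l, of \<gamma> \<delta>U] sol
    by (simp_all add: solves_system_def)
  \<comment> \<open>Negating the second inequality of the system turns the guaranteed decrease into
    a growth bound with rate -\<delta>L.\<close>
  have stepL: "(exp (- \<gamma> * \<alpha> (Suc t) * trace (?C t)) - 1) / trace (?C t) *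
      trace_inner ((1 / trace (mat_exp ((- \<gamma>) *\<^sub>R A t))) *\<^sub>R mat_exp ((- \<gamma>) *\<^sub>R A t)) (?C t) \<le> - \<delta>L"
    if "t < T" for t
  proof -
    have neg: "(x - 1) / y * z = - ((1 - x) / y * z)" for x y z :: real
      by (simp add: divide_inverse algebra_simps)
    show ?thesis
      using sol[OF that] unfolding solves_system_def neg by simp
  qed
  note L = eigenvalue_bound_of_trace_exp_growth[OF assms(1) A A0 A_Suc C stepL l]
  have pos: "0 < real T * \<gamma>"
    using assms(1,4) by simp
  \<comment> \<open>Both bounds are compared after multiplication by the positive number T
    \<gamma>.\<close>
  have clear: "(a / \<gamma> + b / (real T * \<gamma>)) * (real T * \<gamma>) = real T * a + b"
    "(a / \<gamma> - b / (real T * \<gamma>)) * (real T * \<gamma>) = real T * a - b" for a b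
    using assms(1,4) by (simp_all add: field_simps)
  have "l * (real T * \<gamma>) \<le> (ln (1 + \<delta>U) / \<gamma> + ln (real CARD('n)) / (real T * \<gamma>)) * (real T * \<gamma>)"
    unfolding clear using U by (simp add: mult_ac)
  \<comment> \<open>\<open>L\<close> provides both 0 < 1 - \<delta>L and the eigenvalue bound; the
    logarithm of the inverse is minus the logarithm of 1 - \<delta>L.\<close>
  moreover have "(ln (inverse (1 - \<delta>L)) / \<gamma> - ln (real CARD('n)) / (real T * \<gamma>)) * (real T * \<gamma>) \<le> l * (real T * \<gamma>)"
    unfolding clear using L by (simp add: ln_inverse mult_ac)
  ultimately show "ln (inverse (1 - \<delta>L)) / \<gamma> - ln (real CARD('n)) / (real T * \<gamma>) \<le> l \<and>
      l \<le> ln (1 + \<delta>U) / \<gamma> + ln (real CARD('n)) / (real T * \<gamma>)"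
    using pos mult_le_cancel_right_pos by blast
qed

end
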